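(* Let $\mathbb{X}\in\{\mathbb{N},\mathbb{Z}\}$ and let $X\subset S^{\mathbb{X}}$ be a nonempty binary subshift (i.e. $|S|=2$). Then $h(X) = h(W(X))$.
   Context: $S^*$ is the set of finite words over $S$ (including the empty word), and $0\in\mathbb{N}$. Games: let $n \in \mathbb{N}$ or $n=\mathbb{N}$, let $X \subset S^n$ and $a \in \{A,B\}^n$ (the turn order). Two players $A$ and $B$ build a word (infinite sequence if $n=\mathbb{N}$) $w \in S^n$ one letter at a time, starting from coordinate $0$; the letter $w_i$ is chosen by player $a_i$, knowing $w_0\cdots w_{i-1}$. Player $A$ wins if $w \in X$, otherwise $B$ wins. A strategy is a function assigning a letter of $S$ to each finite word of length less than $n$ (any finite word if $n=\mathbb{N}$); a strategy of $A$ is winning if the resulting word lies in $X$ whatever strategy $B$ uses. The winning set is $W(X) = \{a \in \{A,B\}^n : A \text{ has a winning strategy for the game with target set } X \text{ and turn order } a\}$. For a language $L \subset S^*$, $W(L) = \bigcup_{n\in\mathbb{N}} W(L\cap S^n)$. Subshifts: for $F \subset S^*$, let $\mathcal{X}_F$ be the set of $x \in S^{\mathbb{X}}$ in which no word of $F$ appears as a contiguous factor; subshifts are exactly the sets of this form. $\mathcal{B}_n(X)$ is the set of words of length $n$ appearing in points of $X$, and $\mathcal{B}(X)=\bigcup_n\mathcal{B}_n(X)$. The entropy is $h(X) = \lim_{n\to\infty}\frac1n\log_2|\mathcal{B}_n(X)|$. Winning shifts: for a subshift $X\subset S^{\mathbb{N}}$, the winning shift is the winning set $W(X)\subset\{A,B\}^{\mathbb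 N}$, that is, the set of all $a\in\{A,B\}^{\mathbb N}$ such that $A$ has a winning strategy for the game with $n=\mathbb{N}$, target set $X$ and turn order $a$. For a subshift $X \subset S^{\mathbb{Z}}$, it is the two-directional subshift $W(X) = \mathcal{X}_F \subset \{A,B\}^{\mathbb{Z}}$ with $F = \{A,B\}^* \setminus W(\mathcal{B}(X))$. *)

theory Defs
  imports Complex_Main "HOL-Library.Cardinality"
begin

text \<open>
  The alphabet is a type \<open>'s\<close>.  Points of a shift space are functions \<open>'i \<Rightarrow> 's\<close>; the index
  type \<open>'i\<close> is \<^typ>\<open>nat\<close> in the one-sided and \<^typ>\<open>int\<close> in the two-sided case.
\<close>

section \<open>Subshifts\<close>

definition occurs_in :: "'s list \<Rightarrow> ('i::semiring_1 \<Rightarrow> 's) \<Rightarrow> bool" where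
  "occurs_in w x \<longleftrightarrow> (\<exists>i. \<forall>k<length w. x (i + of_nat k) = w ! k)"

definition avoiding :: "'s list set \<Rightarrow> ('i::semiring_1 \<Rightarrow> 's) set" where
  "avoiding F = {x. \<forall>w\<in>F. \<not> occurs_in w x}"

definition subshift :: "('i::semiring_1 \<Rightarrow> 's) set \<Rightarrow> bool" where
  "subshift X \<longleftrightarrow> (\<exists>F. X = avoiding F)"

definition blocks :: "nat \<Rightarrow> ('i::semiring_1 \<Rightarrow> 's) set \<Rightarrow> 's list set" where
  "blocks n X = {w. length w = n \<and> (\<exists>x\<in>X. occurs_in w x)}"

definition language :: "('i::semiring_1 \<Rightarrow> 's) set \<Rightarrow> 's list set" where
  "language X = (\<Union>n. blocks n X)"

text \<open>The limit exists for every nonempty subshift over a finite alphabet.\<close>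

definition entropy :: "('i::semiring_1 \<Rightarrow> 's) set \<Rightarrow> real" where
  "entropy X = lim (\<lambda>n. log 2 (real (card (blocks n X))) / real n)"

section \<open>Word games\<close>

datatype player = PlayerA | PlayerB

type_synonym 's strategy = "'s list \<Rightarrow> 's"

text \<open>
  \<open>play a \<sigma> \<tau> n\<close> is the word consisting of the first \<open>n\<close> letters chosen when the turn order is
  \<open>a\<close> and the players A and B follow \<open>\<sigma>\<close> and \<open>\<tau>\<close>, respectively.  Only the values \<open>a i\<close> for
  \<open>i < n\<close> and the values of the strategies on words of length less than \<open>n\<close> are used, so in a game
  of length \<open>n\<close> it is harmless that strategies are defined on all finite words.
\<close>

primrec play :: "(nat \<Rightarrow> player) \<Rightarrow> 's strategy \<Rightarrow> 's strategy \<Rightarrow> nat \<Rightarrow> 's list" where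
  "play a \<sigma> \<tau> 0 = []"
| "play a \<sigma> \<tau> (Suc i) = play a \<sigma> \<tau> i @
     [(case a i of PlayerA \<Rightarrow> \<sigma> (play a \<sigma> \<tau> i) | PlayerB \<Rightarrow> \<tau> (play a \<sigma> \<tau> i))]"

definition play_inf :: "(nat \<Rightarrow> player) \<Rightarrow> 's strategy \<Rightarrow> 's strategy \<Rightarrow> nat \<Rightarrow> 's" where
  "play_inf a \<sigma> \<tau> i = play a \<sigma> \<tau> (Suc i) ! i"

definition winning_set :: "nat \<Rightarrow> 's list set \<Rightarrow> player list set" where
  "winning_set n X = {a. length a = n \<and> (\<exists>\<sigma>. \<forall>\<tau>. play (\<lambda>i. a ! i) \<sigma> \<tau> n \<in> X)}"

definition winning_set_inf :: "(nat \<Rightarrow> 's) set \<Rightarrow> (nat \<Rightarrow> player) set" where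
  "winning_set_inf X = {a. \<exists>\<sigma>. \<forall>\<tau>. play_inf a \<sigma> \<tau> \<in> X}"

definition winning_language :: "'s list set \<Rightarrow> player list set" where
  "winning_language L = (\<Union>n. winning_set n (L \<inter> {w. length w = n}))"

section \<open>Winning shifts\<close>

definition winning_shift_nat :: "(nat \<Rightarrow> 's) set \<Rightarrow> (nat \<Rightarrow> player) set" where
  "winning_shift_nat X = winning_set_inf X"

definition winning_shift_int :: "(int \<Rightarrow> 's) set \<Rightarrow> (int \<Rightarrow> player) set" where
  "winning_shift_int X = avoiding (- winning_language (language X))"

end

theory Submission
  imports Defs
begin

text \<open>
  For a binary alphabet the winning set of a finite language of words of length \<open>n\<close> has as many
  elements as the language: splitting according to the first letter, the turn order may continue
  in the union of the two smaller winning sets if A moves first and in their intersection if B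
  moves first. In the one-sided case the blocks of the winning shift are exactly the words in the
  winning set of the language, since A can prolong any word of the language by following a point of
  the shift. In the two-sided case a word of the winning language need not be extendable to the
  left, but the winning language is factorial, and dropping the non-extendable words of a factorial
  language does not change the exponential growth rate.
\<close>

section \<open>Finite games\<close>

text \<open>Backward induction replaces strategies by alternating quantifiers, the form suited to
  counting. Words of \<open>X\<close> whose length differs from that of the turn order are never
  reached, so a whole language can serve as target.\<close>

primrec wins :: "player list \<Rightarrow> 's list set \<Rightarrow> bool" where
  "wins [] X \<longleftrightarrow> [] \<in> X"
| "wins (c # a) X \<longleftrightarrow> (case c of PlayerA \<Rightarrow> \<exists>s. wins a {w. s # w \<in> X}
                                | PlayerB \<Rightarrow> \<forall>s. wins a {w. s # w \<in> X})"

lemma length_play [simp]: "length (play a \<sigma> \<tau> n) = n"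
  by (induction n) auto

lemma take_play: "m \<le> n \<Longrightarrow> take m (play a \<sigma> \<tau> n) = play a \<sigma> \<tau> m"
  by (induction n) (auto simp: le_Suc_eq)

lemma play_cong:
  assumes "\<And>i. i < n \<Longrightarrow> a i = b i"
    and "\<And>w. length w < n \<Longrightarrow> \<sigma> w = \<sigma>' w" and "\<And>w. length w < n \<Longrightarrow> \<tau> w = \<tau>' w"
  shows "play a \<sigma> \<tau> n = play b \<sigma>' \<tau>' n"
  using assms by (induction n) (auto split: player.splits)

text \<open>\<open>play\<close> grows at the end whereas \<open>wins\<close> peels off the first
  move; this recursion at the front reconciles the two.\<close>

lemma play_Suc_Cons:
  fixes a :: "nat \<Rightarrow> player" and \<sigma> \<tau> :: "'s strategy"
  defines "s \<equiv> (case a 0 of PlayerA \<Rightarrow> \<sigma> [] | PlayerB \<Rightarrow> \<tau> [])"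
  shows "play a \<sigma> \<tau> (Suc n) = s # play (\<lambda>i. a (Suc i)) (\<lambda>w. \<sigma> (s # w)) (\<lambda>w. \<tau> (s # w)) n"
proof (induction n)
  case (Suc n)
  then show ?case
    by (simp only: play.simps(2)[of a \<sigma> \<tau> "Suc n"] play.simps(2)[of "\<lambda>i. a (Suc i)"] append_Cons)
qed (simp add: s_def split: player.split)

lemma wins_iff_strategy: "wins a X \<longleftrightarrow> (\<exists>\<sigma>. \<forall>\<tau>. play (\<lambda>i. a ! i) \<sigma> \<tau> (length a) \<in> X)"
proof (induction a arbitrary: X)
  case (Cons c a)
  show ?case
  proof (cases c)
    case PlayerA
    have "(\<exists>s \<sigma>. \<forall>\<tau>. s # play (\<lambda>i. a ! i) \<sigma> \<tau> (length a) \<in> X) \<longleftrightarrow>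
      (\<exists>\<sigma>. \<forall>\<tau>. \<sigma> [] # play (\<lambda>i. a ! i) (\<lambda>w. \<sigma> (\<sigma> [] # w)) (\<lambda>w. \<tau> (\<sigma> [] # w)) (length a) \<in> X)"
      (is "?l \<longleftrightarrow> ?r")
    proof
      assume ?l
      then obtain s \<sigma> where *: "\<And>\<tau>. s # play (\<lambda>i. a ! i) \<sigma> \<tau> (length a) \<in> X" by blast
      show ?r
        \<comment> \<open>Open with \<open>s\<close>, then forget the first letter and follow
          \<open>\<sigma>\<close>.\<close>
        by (rule exI[of _ "\<lambda>w. case w of [] \<Rightarrow> s | _ # v \<Rightarrow> \<sigma> v"]) (simp add: *)
    next
      assume ?r
      then obtain \<sigma> where *: "\<And>\<tau>. \<sigma> [] # play (\<lambda>i. a ! i) (\<lambda>w. \<sigma> (\<sigma> [] # w))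
          (\<lambda>w. \<tau> (\<sigma> [] # w)) (length a) \<in> X" by blast
      have "\<sigma> [] # play (\<lambda>i. a ! i) (\<lambda>w. \<sigma> (\<sigma> [] # w)) \<tau> (length a) \<in> X" for \<tau>
        \<comment> \<open>A counterstrategy for the shorter game is lifted to the full game by
          ignoring the first letter.\<close>
        using *[of "\<lambda>w. \<tau> (tl w)"] by simp
      then show ?l by blast
    qed
    then show ?thesis
      by (simp add: PlayerA Cons.IH play_Suc_Cons del: play.simps(2))
  next
    case PlayerB
    have "(\<forall>s. \<exists>\<sigma>. \<forall>\<tau>. s # play (\<lambda>i. a ! i) \<sigma> \<tau> (length a) \<in> X) \<longleftrightarrow>
      (\<exists>\<sigma>. \<forall>\<tau>. \<tau> [] # play (\<lambda>i. a ! i) (\<lambda>w. \<sigma> (\<tau> [] # w)) (\<lambda>w. \<tau> (\<tau> [] # w)) (length a) \<in> X)"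
      (is "?l \<longleftrightarrow> ?r")
    proof
      assume ?l
      then obtain \<sigma> where *: "\<And>s \<tau>. s # play (\<lambda>i. a ! i) (\<sigma> s) \<tau> (length a) \<in> X" by metis
      show ?r
        \<comment> \<open>B's opening letter is still visible as the head of the word and selects
          the strategy for the rest. The value on the empty word never matters, since B moves
          first.\<close>
        by (rule exI[of _ "\<lambda>w. \<sigma> (hd w) (tl w)"]) (simp add: *)
    next
      assume ?r
      then obtain \<sigma> where *: "\<And>\<tau>. \<tau> [] # play (\<lambda>i. a ! i) (\<lambda>w. \<sigma> (\<tau> [] # w))
          (\<lambda>w. \<tau> (\<tau> [] # w)) (length a) \<in> X" by blast
      have "s # play (\<lambda>i. a ! i) (\<lambda>w. \<sigma> (s # w)) \<tau> (length a) \<in> X" for s \<tau>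
        \<comment> \<open>Consider the plays in which B opens with \<open>s\<close>.\<close>
        using *[of "\<lambda>w. case w of [] \<Rightarrow> s | _ # v \<Rightarrow> \<tau> v"] by simp
      then show ?l by blast
    qed
    then show ?thesis
      by (simp add: PlayerB Cons.IH play_Suc_Cons del: play.simps(2))
  qed
qed simp

section \<open>Monotonicity, concatenation and word lengths in finite games\<close>

lemma wins_mono: "wins a X \<Longrightarrow> X \<subseteq> Y \<Longrightarrow> wins a Y"
proof (induction a arbitrary: X Y)
  case (Cons c a)
  have "{w. s # w \<in> X} \<subseteq> {w. s # w \<in> Y}" for s using Cons.prems by auto
  then show ?case using Cons by (auto split: player.splits) blast+
qed auto

text \<open>Two-stage reading: during \<open>a\<close>, A aims for the positions from which the game
  on \<open>b\<close> is won. This isolates a factor of a turn order.\<close>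

lemma wins_append: "wins (a @ b) X \<longleftrightarrow> wins a {u. wins b {w. u @ w \<in> X}}"
  by (induction a arbitrary: X) (auto split: player.splits)

lemma wins_nonempty: "wins a X \<Longrightarrow> \<exists>w\<in>X. length w = length a"
proof (induction a arbitrary: X)
  case (Cons c a)
  then obtain s where "wins a {w. s # w \<in> X}" by (auto split: player.splits)
  then obtain w where "s # w \<in> X" "length w = length a" using Cons.IH by blast
  then show ?case by (metis length_Cons)
qed auto

lemma wins_restrict_length: "wins a (X \<inter> {w. length w = length a}) \<longleftrightarrow> wins a X"
  unfolding wins_iff_strategy by simp

lemma winning_language_eq: "winning_language L = {a. wins a L}"
proof -
  have "a \<in> winning_set n (L \<inter> {w. length w = n}) \<longleftrightarrow> length a = n \<and> wins a L" for a n
    using wins_restrict_length[of a L] by (auto simp: winning_set_def wins_iff_strategy)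
  then show ?thesis by (auto simp: winning_language_def)
qed

section \<open>Counting winning turn orders over two letters\<close>

lemma finite_UNIV_player: "finite (UNIV :: player set)"
proof -
  have "(UNIV :: player set) = {PlayerA, PlayerB}" using player.exhaust by auto
  then show ?thesis by (metis finite.emptyI finite.insertI)
qed

lemma finite_words_length:
  assumes "finite (UNIV :: 'a set)"
  shows "finite {w :: 'a list. length w = n \<and> P w}"
  by (rule finite_subset[OF _ finite_lists_length_eq[OF assms, of n]]) auto

text \<open>With only two letters, a move of A gives the union and a move of B the intersection of
  two sets, and |P \<union> Q| + |P \<inter> Q| = |P| + |Q|. The induction is over all
  \<open>X\<close> because the hypothesis is applied to the residual targets \<open>Y p\<close> and
  \<open>Y q\<close>.\<close>

lemma card_wins:
  fixes X :: "'s list set"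
  assumes "CARD('s) = 2"
  shows "card {a. length a = n \<and> wins a X} = card {w. length w = n \<and> w \<in> X}"
proof (induction n arbitrary: X)
  case 0
  have "{a. length a = 0 \<and> wins a X} = (if [] \<in> X then {[]} else {})"
    and "{w. length w = 0 \<and> w \<in> X} = (if [] \<in> X then {[]} else {})" by auto
  then show ?case by simp
next
  case (Suc n)
  obtain p q :: 's where pq: "(UNIV :: 's set) = {p, q}" "p \<noteq> q"
    using assms by (auto simp: card_2_iff)
  have fin: "finite (UNIV :: 's set)" using assms by (simp add: card_ge_0_finite)
  define Y where "Y s = {w. s # w \<in> X}" for s
  define W where "W s = {a. length a = n \<and> wins a (Y s)}" for s
  define V where "V s = {w. length w = n \<and> w \<in> Y s}" for s
  have quant: "(\<exists>s. P s) \<longleftrightarrow> P p \<or> P q" "(\<forall>s. P s) \<longleftrightarrow> P p \<and> P q" for P :: "'s \<Rightarrow> bool"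
    using pq UNIV_I by (metis insertE singletonD)+
  have finW: "finite (W s)" for s
    unfolding W_def by (rule finite_words_length[OF finite_UNIV_player])
  have finV: "finite (V s)" for s
    unfolding V_def by (rule finite_words_length[OF fin])
  have "{a. length a = Suc n \<and> wins a X} =
      (#) PlayerA ` (W p \<union> W q) \<union> (#) PlayerB ` (W p \<inter> W q)"
    (is "?l = ?r")
  proof (rule set_eqI)
    fix a
    show "a \<in> ?l \<longleftrightarrow> a \<in> ?r"
    proof (cases a)
      case (Cons c b)
      then show ?thesis by (cases c) (auto simp: quant W_def Y_def)
    qed auto
  qed
  then have "card {a. length a = Suc n \<and> wins a X} = card (W p \<union> W q) + card (W p \<inter> W q)"
    using finW by (simp only:) (subst card_Un_disjoint; auto simp: card_image)
  also have "\<dots> = card (W p) + card (W q)"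
    using card_Un_Int[OF finW finW] by simp
  also have "\<dots> = card (V p) + card (V q)"
    unfolding W_def V_def by (simp add: Suc.IH)
  also have "\<dots> = card ((#) p ` V p \<union> (#) q ` V q)"
    using finV pq by (subst card_Un_disjoint) (auto simp: card_image)
  also have "(#) p ` V p \<union> (#) q ` V q = {w. length w = Suc n \<and> w \<in> X}"
    (is "?l = ?r")
  proof (rule set_eqI)
    fix w
    show "w \<in> ?l \<longleftrightarrow> w \<in> ?r"
    proof (cases w)
      case (Cons s v)
      have "s = p \<or> s = q" using pq by (metis UNIV_I insertE singletonD)
      then show ?thesis using Cons by (auto simp: V_def Y_def)
    qed (auto simp: V_def)
  qed
  finally show ?case .
qed

section \<open>Languages of subshifts\<close>

definition factorial_language :: "'a list set \<Rightarrow> bool" where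
  "factorial_language L \<longleftrightarrow> (\<forall>u v w. u @ v @ w \<in> L \<longrightarrow> v \<in> L)"

lemma factorial_languageD: "factorial_language L \<Longrightarrow> u @ v @ w \<in> L \<Longrightarrow> v \<in> L"
  unfolding factorial_language_def by blast

lemma mem_language: "w \<in> language X \<longleftrightarrow> (\<exists>x\<in>X. occurs_in w x)"
  by (auto simp: language_def blocks_def)

lemma blocks_eq_language: "blocks n X = {w. length w = n \<and> w \<in> language X}"
  by (auto simp: language_def blocks_def)

lemma occurs_in_factor:
  fixes x :: "'i::semiring_1 \<Rightarrow> 's"
  assumes "occurs_in (u @ v @ w) x"
  shows "occurs_in v x"
proof -
  obtain i where i: "\<forall>k<length (u @ v @ w). x (i + of_nat k) = (u @ v @ w) ! k"
    using assms by (auto simp: occurs_in_def)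
  have "x ((i + of_nat (length u)) + of_nat k) = v ! k" if "k < length v" for k
    using i[rule_format, of "length u + k"] that by (simp add: nth_append add.assoc)
  then show ?thesis by (auto simp: occurs_in_def)
qed

lemma factorial_language_language: "factorial_language (language X)"
  unfolding factorial_language_def mem_language using occurs_in_factor by blast

lemma language_nonempty:
  fixes X :: "('i::semiring_1 \<Rightarrow> 's) set"
  assumes "X \<noteq> {}"
  shows "\<exists>w\<in>language X. length w = n"
proof -
  obtain x where x: "x \<in> X" using assms by auto
  have "occurs_in (map (\<lambda>k. x (of_nat k)) [0..<n]) x"
    unfolding occurs_in_def by (rule exI[of _ 0]) simp
  then show ?thesis using x by (force simp: mem_language)
qed

text \<open>The moves before \<open>b\<close> are settled by fixing one favourable word
  \<open>u\<close>; the moves after \<open>b\<close> are dropped because any won continuation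
  contains the word played on \<open>b\<close> as a factor.\<close>

lemma factorial_language_wins:
  assumes L: "factorial_language L"
  shows "factorial_language {a. wins a L}"
  unfolding factorial_language_def
proof (intro allI impI, simp)
  fix a b c assume "wins (a @ b @ c) L"
  then obtain u where "wins (b @ c) {w. u @ w \<in> L}"
    using wins_nonempty unfolding wins_append[of a] by blast
  then have *: "wins b {v. wins c {w. u @ v @ w \<in> L}}"
    by (simp add: wins_append)
  \<comment> \<open>A won game has a nonempty target, so some \<open>u @ v @ w\<close> lies in
    \<open>L\<close>.\<close>
  have "{v. wins c {w. u @ v @ w \<in> L}} \<subseteq> L"
    using wins_nonempty factorial_languageD[OF L] by blast
  with * show "wins b L" by (rule wins_mono)
qed

lemma card_blocks_eq_card_wins:
  fixes X :: "('i::semiring_1 \<Rightarrow> 's) set"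
  assumes "CARD('s) = 2"
  shows "card (blocks n X) = card {a. length a = n \<and> wins a (language X)}"
  by (simp add: blocks_eq_language card_wins[OF assms])

section \<open>The one-sided case\<close>

text \<open>A forbidden word in the shifted sequence would also occur in \<open>x\<close>,
  \<open>i\<close> places further on.\<close>

lemma subshift_nat_shift:
  fixes X :: "(nat \<Rightarrow> 's) set"
  assumes "subshift X" "x \<in> X"
  shows "(\<lambda>k. x (i + k)) \<in> X"
proof -
  obtain F where F: "X = avoiding F" using assms by (auto simp: subshift_def)
  have "occurs_in w x" if "occurs_in w (\<lambda>k. x (i + k))" for w
    using that unfolding occurs_in_def by (metis add.assoc)
  then show ?thesis using assms(2) by (auto simp: F avoiding_def)
qed

lemma subshift_nat_language:
  fixes X :: "(nat \<Rightarrow> 's) set"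
  assumes "subshift X" "w \<in> language X"
  obtains x where "x \<in> X" "\<And>k. k < length w \<Longrightarrow> x k = w ! k"
proof -
  obtain y i where y: "y \<in> X" "\<And>k. k < length w \<Longrightarrow> y (i + k) = w ! k"
    using assms(2) by (auto simp: mem_language occurs_in_def)
  show ?thesis using that[of "\<lambda>k. y (i + k)"] subshift_nat_shift[OF assms(1) y(1)] y(2) by auto
qed

lemma play_inf_prefix: "map (play_inf a \<sigma> \<tau>) [0..<n] = play a \<sigma> \<tau> n"
proof (rule nth_equalityI)
  fix i assume "i < length (map (play_inf a \<sigma> \<tau>) [0..<n])"
  then show "map (play_inf a \<sigma> \<tau>) [0..<n] ! i = play a \<sigma> \<tau> n ! i"
    using take_play[of "Suc i" n a \<sigma> \<tau>] by (simp add: play_inf_def del: play.simps) (metis lessI nth_take)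
qed simp

text \<open>The infinite strategy, stopped after \<open>n\<close> moves, produces only prefixes of
  points of \<open>X\<close>.\<close>

lemma winning_set_inf_prefix:
  assumes "a \<in> winning_set_inf X"
  shows "wins (map a [0..<n]) (language X)"
proof -
  obtain \<sigma> where \<sigma>: "\<And>\<tau>. play_inf a \<sigma> \<tau> \<in> X"
    using assms by (auto simp: winning_set_inf_def)
  have "play (\<lambda>i. map a [0..<n] ! i) \<sigma> \<tau> n \<in> language X" for \<tau>
  proof -
    have "play (\<lambda>i. map a [0..<n] ! i) \<sigma> \<tau> n = map (play_inf a \<sigma> \<tau>) [0..<n]"
      unfolding play_inf_prefix by (rule play_cong) auto
    moreover have "occurs_in (map (play_inf a \<sigma> \<tau>) [0..<n]) (play_inf a \<sigma> \<tau>)"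
      unfolding occurs_in_def by (rule exI[of _ 0]) simp
    ultimately show ?thesis using \<sigma>[of \<tau>] unfolding mem_language by auto
  qed
  then show ?thesis by (auto simp: wins_iff_strategy)
qed

text \<open>Once \<open>u\<close> is used up A owns every turn and copies the letters of a point of
  \<open>X\<close> that starts with the word built so far.\<close>

lemma winning_set_inf_extend:
  fixes X :: "(nat \<Rightarrow> 's) set"
  assumes "subshift X" and u: "wins u (language X)"
  shows "(\<lambda>i. if i < length u then u ! i else PlayerA) \<in> winning_set_inf X"
proof -
  let ?n = "length u" and ?a = "\<lambda>i. if i < length u then u ! i else PlayerA"
  obtain \<sigma>0 where \<sigma>0: "\<And>\<tau>. play (\<lambda>i. u ! i) \<sigma>0 \<tau> ?n \<in> language X"
    using u by (auto simp: wins_iff_strategy)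
  have "\<forall>w\<in>language X. \<exists>x\<in>X. \<forall>k<length w. x k = w ! k"
    using subshift_nat_language[OF assms(1)] by metis
  then obtain ext where ext: "\<And>w. w \<in> language X \<Longrightarrow> ext w \<in> X"
    "\<And>w k. w \<in> language X \<Longrightarrow> k < length w \<Longrightarrow> ext w k = w ! k"
    by metis
  \<comment> \<open>Only the first \<open>?n\<close> letters determine the point to copy, so all
    later moves follow the same point.\<close>
  define \<sigma> where "\<sigma> w = (if length w < ?n then \<sigma>0 w else ext (take ?n w) (length w))" for w
  have "play_inf ?a \<sigma> \<tau> \<in> X" for \<tau>
  proof -
    define w where "w = play ?a \<sigma> \<tau> ?n"
    have "w = play (\<lambda>i. u ! i) \<sigma>0 \<tau> ?n"
      unfolding w_def by (rule play_cong) (auto simp: \<sigma>_def)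
    then have w: "w \<in> language X" using \<sigma>0 by simp
    have "play_inf ?a \<sigma> \<tau> k = ext w k" for k
    proof (cases "k < ?n")
      case True
      then have "play_inf ?a \<sigma> \<tau> k = map (play_inf ?a \<sigma> \<tau>) [0..<?n] ! k" by simp
      also have "\<dots> = w ! k" by (simp add: play_inf_prefix w_def del: map_map)
      finally show ?thesis using ext(2)[OF w] True by (simp add: w_def)
    next
      case False
      then have "take ?n (play ?a \<sigma> \<tau> k) = w" by (simp add: take_play w_def)
      then show ?thesis using False by (simp add: play_inf_def nth_append \<sigma>_def)
    qed
    then have "play_inf ?a \<sigma> \<tau> = ext w" by auto
    then show ?thesis using ext(1)[OF w] by simp
  qed
  then show ?thesis by (auto simp: winning_set_inf_def)
qed

lemma blocks_winning_shift_nat: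
  fixes X :: "(nat \<Rightarrow> 's) set"
  assumes "subshift X"
  shows "blocks n (winning_shift_nat X) = {a. length a = n \<and> wins a (language X)}"
proof (intro equalityI subsetI)
  fix u assume "u \<in> blocks n (winning_shift_nat X)"
  then obtain a i where a: "a \<in> winning_set_inf X" and len: "length u = n"
    and u: "\<And>k. k < n \<Longrightarrow> a (i + k) = u ! k"
    by (auto simp: blocks_def winning_shift_nat_def occurs_in_def)
  have "a j = u ! (j - i)" if "i \<le> j" "j < i + n" for j
    using u[of "j - i"] that by simp
  \<comment> \<open>An occurrence at position \<open>i\<close> is the end of a prefix of
    \<open>a\<close>; factoriality of the winning language then removes the beginning.\<close>
  then have "map a [0..<i + n] = map a [0..<i] @ u"
    using len by (intro nth_equalityI) (auto simp: nth_append)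
  then have "map a [0..<i] @ u @ [] \<in> {a. wins a (language X)}"
    using winning_set_inf_prefix[OF a, of "i + n"] by (simp del: map_map)
  then show "u \<in> {a. length a = n \<and> wins a (language X)}"
    using factorial_languageD[OF factorial_language_wins[OF factorial_language_language]] len
    by blast
next
  fix u assume "u \<in> {a. length a = n \<and> wins a (language X)}"
  then have len: "length u = n" and "wins u (language X)" by auto
  from winning_set_inf_extend[OF assms this(2)]
  have "(\<lambda>i. if i < length u then u ! i else PlayerA) \<in> winning_shift_nat X"
    by (simp add: winning_shift_nat_def)
  moreover have "occurs_in u (\<lambda>i::nat. if i < length u then u ! i else PlayerA)"
    unfolding occurs_in_def by (rule exI[of _ 0]) simp
  ultimately show "u \<in> blocks n (winning_shift_nat X)"
    using len by (auto simp: blocks_def)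
qed

section \<open>Factorial languages and two-sided subshifts\<close>

text \<open>Finite-depth approximation: holding for every \<open>m\<close> characterises, by
  compactness, the words that occur in a bi-infinite point all of whose factors lie in a factorial
  \<open>L\<close> over a finite alphabet.\<close>

definition extendable :: "'a list set \<Rightarrow> nat \<Rightarrow> 'a list \<Rightarrow> bool" where
  "extendable L m u \<longleftrightarrow> (\<exists>p q. length p = m \<and> length q = m \<and> p @ u @ q \<in> L)"

text \<open>Overlong contexts are trimmed from their outer ends, which factoriality permits.\<close>

lemma extendable_factor:
  assumes L: "factorial_language L" and "p' @ u @ q' \<in> L" "m \<le> length p'" "m \<le> length q'"
  shows "extendable L m u"
proof -
  let ?j = "length p' - m"
  have "take ?j p' @ (drop ?j p' @ u @ take m q') @ drop m q' \<in> L"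
    using assms(2) by (metis append.assoc append_take_drop_id)
  from factorial_languageD[OF L this] show ?thesis
    using assms(3,4) unfolding extendable_def
    by (intro exI[of _ "drop ?j p'"] exI[of _ "take m q'"]) auto
qed

lemma extendable_antimono:
  "factorial_language L \<Longrightarrow> extendable L n u \<Longrightarrow> m \<le> n \<Longrightarrow> extendable L m u"
  by (metis extendable_def extendable_factor)

text \<open>Assign to each \<open>a\<close> an index where the property fails, if there is one; the
  maximum of these over the finite set \<open>A\<close> is a common threshold.\<close>

lemma antimono_uniform_bound:
  fixes P :: "nat \<Rightarrow> 'b \<Rightarrow> bool"
  assumes "finite A" and anti: "\<And>a m n. P n a \<Longrightarrow> m \<le> n \<Longrightarrow> P m a"
  shows "\<exists>N. \<forall>a\<in>A. P N a \<longrightarrow> (\<forall>m. P m a)"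
proof -
  have "\<forall>a. \<exists>N. P N a \<longrightarrow> (\<forall>m. P m a)" by auto
  from choice[OF this] obtain f where f: "\<And>a. P (f a) a \<Longrightarrow> \<forall>m. P m a" by blast
  have "f a \<le> Max (f ` A)" if "a \<in> A" for a using that assms(1) by simp
  then show ?thesis using f anti by blast
qed

text \<open>This is the compactness step: one depth \<open>N\<close> decides unlimited extendability
  for all pairs of neighbouring letters at once.\<close>

lemma extendable_step:
  fixes L :: "'a list set"
  assumes L: "factorial_language L" and fin: "finite (UNIV :: 'a set)"
    and u: "\<And>m. extendable L m u"
  shows "\<exists>a b. \<forall>m. extendable L m (a # u @ [b])"
proof -
  have "finite (UNIV :: ('a \<times> 'a) set)" using fin by (simp add: finite_Prod_UNIV)
  then have "\<exists>N. \<forall>ab\<in>UNIV. extendable L N (fst ab # u @ [snd ab]) \<longrightarrow>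
      (\<forall>m. extendable L m (fst ab # u @ [snd ab]))"
    by (rule antimono_uniform_bound) (rule extendable_antimono[OF L])
  then obtain N
    where N: "\<And>a b. extendable L N (a # u @ [b]) \<Longrightarrow> \<forall>m. extendable L m (a # u @ [b])"
    by auto
  \<comment> \<open>Depth \<open>Suc N\<close> pays for one new letter on each side and leaves
    contexts of length \<open>N\<close>.\<close>
  obtain p q where pq: "length p = Suc N" "length q = Suc N" "p @ u @ q \<in> L"
    using u[of "Suc N"] by (auto simp: extendable_def)
  obtain p' a where p: "p = p' @ [a]" using pq(1) by (metis length_Suc_conv_rev)
  obtain b q' where q: "q = b # q'" using pq(2) by (metis length_Suc_conv)
  have "extendable L N (a # u @ [b])"
    unfolding extendable_def using pq p q by (intro exI[of _ p'] exI[of _ q']) simp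
  then show ?thesis using N by blast
qed

text \<open>The bi-infinite point is the union of a chain of words growing by one letter on each side.\<close>

lemma extendable_in_blocks:
  fixes L :: "'a list set"
  assumes L: "factorial_language L" and fin: "finite (UNIV :: 'a set)"
    and u: "\<And>m. extendable L m u"
  shows "u \<in> blocks (length u) (avoiding (- L) :: (int \<Rightarrow> 'a) set)"
proof -
  \<comment> \<open>The clause for \<open>k = 0\<close> makes the chain start at \<open>u\<close>
    itself.\<close>
  have "\<exists>f. \<forall>k. ((\<forall>m. extendable L m (f k)) \<and> (k = 0 \<longrightarrow> f k = u)) \<and> (\<exists>a b. f (Suc k) = a # f k @ [b])"
  proof (rule dependent_nat_choice)
    show "\<exists>x. (\<forall>m. extendable L m x) \<and> (0 = (0::nat) \<longrightarrow> x = u)" using u by auto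
    show "\<exists>y. ((\<forall>m. extendable L m y) \<and> (Suc k = 0 \<longrightarrow> y = u)) \<and> (\<exists>a b. y = a # x @ [b])"
      if "(\<forall>m. extendable L m x) \<and> (k = 0 \<longrightarrow> x = u)" for x k
      using extendable_step[OF L fin, of x] that by blast
  qed
  then obtain f where ext: "\<And>k m. extendable L m (f k)" and f0: "f 0 = u"
    and step: "\<And>k. \<exists>a b. f (Suc k) = a # f k @ [b]" by blast
  have fL: "f k \<in> L" for k using ext[of 0 k] by (simp add: extendable_def)
  have len: "length (f k) = length u + 2 * k" for k
  proof (induction k)
    case (Suc k)
    then show ?case using step[of k] by auto
  qed (simp add: f0)
  have shift: "f (k + j) ! (t + j) = f k ! t" if "t < length (f k)" for k j t
  proof (induction j)
    case (Suc j)
    obtain a b where "f (Suc (k + j)) = a # f (k + j) @ [b]" using step by blast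
    then show ?case using Suc that by (simp add: nth_append len)
  qed simp
  \<comment> \<open>Coordinate 0 sits at index \<open>k\<close> of \<open>f k\<close>, where
    \<open>u\<close> begins. The extra 1 keeps the index within the word even when \<open>u\<close>
    is empty.\<close>
  define x where "x i = f (nat \<bar>i\<bar> + 1) ! nat (i + \<bar>i\<bar> + 1)" for i :: int
  have x: "x i = f k ! nat (i + int k)" if "nat \<bar>i\<bar> + 1 \<le> k" for i k
  proof -
    define j where "j = k - (nat \<bar>i\<bar> + 1)"
    have k: "k = nat \<bar>i\<bar> + 1 + j" using that by (simp add: j_def)
    have "nat (i + int k) = nat (i + \<bar>i\<bar> + 1) + j" using k by linarith
    moreover have "nat (i + \<bar>i\<bar> + 1) < length (f (nat \<bar>i\<bar> + 1))"
      unfolding len by (subst nat_less_iff) auto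
    ultimately show ?thesis using shift[of "nat (i + \<bar>i\<bar> + 1)" "nat \<bar>i\<bar> + 1" j] k
      by (simp add: x_def)
  qed
  have "w \<in> L" if w: "occurs_in w x" for w
  proof -
    obtain i where i: "\<And>k. k < length w \<Longrightarrow> x (i + int k) = w ! k"
      using w by (auto simp: occurs_in_def)
    \<comment> \<open>Large enough for \<open>f K\<close> to cover every coordinate of this
      occurrence of \<open>w\<close>.\<close>
    define K where "K = nat \<bar>i\<bar> + length w + 1"
    define s where "s = nat (i + int K)"
    have s: "int s = i + int K" unfolding s_def K_def by linarith
    have "s \<le> 2 * nat \<bar>i\<bar> + length w + 1"
      unfolding s_def K_def nat_le_iff by simp
    then have sK: "s + length w \<le> length (f K)" unfolding len K_def by simp
    have "w = take (length w) (drop s (f K))"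
    proof (rule nth_equalityI)
      fix k assume k: "k < length w"
      have "w ! k = f K ! nat (i + int k + int K)"
        using i[OF k] x[of "i + int k" K] k by (simp add: K_def)
      also have "nat (i + int k + int K) = s + k" using s by linarith
      finally show "w ! k = take (length w) (drop s (f K)) ! k" using k sK by simp
    qed (use sK in simp)
    then have "take s (f K) @ w @ drop (length w) (drop s (f K)) \<in> L"
      using fL[of K] by (metis append_take_drop_id)
    then show ?thesis using factorial_languageD[OF L] by blast
  qed
  then have "x \<in> avoiding (- L)" by (auto simp: avoiding_def)
  moreover have "occurs_in u x"
    unfolding occurs_in_def
  proof (intro exI[of _ 0] allI impI)
    fix k assume k: "k < length u"
    have "nat (int k + int (k + 1)) = k + (k + 1)" by linarith
    then show "x (0 + of_nat k) = u ! k"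
      using x[of "int k" "k + 1"] shift[of k 0 "k + 1"] k by (simp add: f0)
  qed
  ultimately show ?thesis by (auto simp: blocks_def)
qed

section \<open>Growth rate and entropy of factorial languages\<close>

lemma blocks_avoiding_subset:
  "blocks n (avoiding (- L) :: ('i::semiring_1 \<Rightarrow> 'a) set) \<subseteq> {w. length w = n \<and> w \<in> L}"
  by (auto simp: blocks_def avoiding_def)

lemma card_le_card_mult:
  assumes "finite B" "finite C" "A \<subseteq> (\<lambda>(u, v). u @ v) ` (B \<times> C)"
  shows "card A \<le> card B * card C"
  using surj_card_le[OF _ assms(3)] assms(1,2) by (simp add: card_cartesian_product)

text \<open>
  All but the outermost \<open>N\<close> letters on both sides of a long word of \<open>L\<close> can be cut into words of
  length \<open>n\<close> that are indefinitely extendable.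
\<close>

lemma card_factorial_language_le:
  fixes L :: "'a list set"
  assumes L: "factorial_language L" and fin: "finite (UNIV :: 'a set)" and n: "n > 0"
    and ne: "\<And>m. \<exists>w\<in>L. length w = m"
  defines "E \<equiv> blocks n (avoiding (- L) :: (int \<Rightarrow> 'a) set)"
  shows "card E > 0"
    and "\<exists>C N. \<forall>m. card {w. length w = m + N \<and> w \<in> L} \<le> C * card E ^ (m div n)"
proof -
  define Lw where "Lw m = {w. length w = m \<and> w \<in> L}" for m
  have finL: "finite (Lw m)" for m
    unfolding Lw_def by (rule finite_words_length[OF fin])
  have finE: "finite E"
    unfolding E_def by (rule finite_subset[OF blocks_avoiding_subset finite_words_length[OF fin]])
  \<comment> \<open>There are finitely many words of length \<open>n\<close>, so one depth
    \<open>N\<close> detects unlimited extendability for all of them.\<close>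
  obtain N where N: "\<And>u. u \<in> Lw n \<Longrightarrow> extendable L N u \<Longrightarrow> \<forall>m. extendable L m u"
    using antimono_uniform_bound[OF finL, of "extendable L" n] extendable_antimono[OF L] by meson
  have inE: "u \<in> E" if "length u = n" "extendable L N u" for u
  proof -
    have "u \<in> L" using that(2) factorial_languageD[OF L] by (auto simp: extendable_def)
    then have "\<And>m. extendable L m u" using N that by (auto simp: Lw_def)
    from extendable_in_blocks[OF L fin this] show ?thesis using that(1) by (simp add: E_def)
  qed
  obtain w where w: "w \<in> L" "length w = N + n + N" using ne by blast
  have "take N w @ take n (drop N w) @ drop n (drop N w) \<in> L"
    using w by (metis append_take_drop_id)
  then have "extendable L N (take n (drop N w))"
    by (rule extendable_factor[OF L]) (use w in auto)
  then have "take n (drop N w) \<in> E" using w by (intro inE) auto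
  then show "card E > 0" using finE by (auto simp: card_gt_0_iff)
  \<comment> \<open>The depth stays \<open>N\<close> for every length \<open>k\<close>. It is
    decisive only for length \<open>n\<close>, which suffices because words are cut into pieces of
    that length.\<close>
  define D where "D k = {u. length u = k \<and> extendable L N u}" for k
  have finD: "finite (D k)" for k
    unfolding D_def by (rule finite_words_length[OF fin])
  have D_step: "card (D (k + n)) \<le> card E * card (D k)" for k
  proof (rule card_le_card_mult[OF finE finD], rule subsetI)
    fix w assume "w \<in> D (k + n)"
    then obtain p q where pq: "length w = k + n" "length p = N" "length q = N" "p @ w @ q \<in> L"
      by (auto simp: D_def extendable_def)
    have *: "p @ take n w @ (drop n w @ q) \<in> L" "(p @ take n w) @ drop n w @ q \<in> L"
      using pq(4) by (metis append.assoc append_take_drop_id)+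
    have "extendable L N (take n w)" "extendable L N (drop n w)"
      by (rule extendable_factor[OF L *(1)]; simp add: pq)
        (rule extendable_factor[OF L *(2)]; simp add: pq)
    then have "take n w \<in> E" "drop n w \<in> D k" using pq inE by (auto simp: D_def)
    then show "w \<in> (\<lambda>(u, v). u @ v) ` (E \<times> D k)"
      by (intro image_eqI[of _ _ "(take n w, drop n w)"]) auto
  qed
  have D_mult: "card (D (r + q * n)) \<le> card E ^ q * card (D r)" for r q
  proof (induction q)
    case (Suc q)
    have "card (D (r + Suc q * n)) \<le> card E * card (D (r + q * n))"
      using D_step[of "r + q * n"] by (simp add: algebra_simps)
    also have "\<dots> \<le> card E * (card E ^ q * card (D r))" using Suc by (rule mult_le_mono2)
    finally show ?case by (simp add: mult.assoc)
  qed simp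
  \<comment> \<open>Absorbs the leftover piece, whose length is \<open>m mod n\<close>.\<close>
  define C where "C = (\<Sum>r<n. card (D r))"
  have D_le: "card (D m) \<le> C * card E ^ (m div n)" for m
  proof -
    have "card (D (m mod n)) \<le> C"
      unfolding C_def using n by (intro member_le_sum) auto
    then have "card E ^ (m div n) * card (D (m mod n)) \<le> card E ^ (m div n) * C"
      by (rule mult_le_mono2)
    moreover have "card (D m) \<le> card E ^ (m div n) * card (D (m mod n))"
      using D_mult[of "m mod n" "m div n"] by simp
    ultimately show ?thesis by (metis le_trans mult.commute)
  qed
  \<comment> \<open>The two outer pieces of length \<open>N\<close> are counted crudely by
    \<open>Lw N\<close>; the middle piece then has contexts of length \<open>N\<close> and lies in
    \<open>D m\<close>.\<close>
  have "card (Lw (m + 2 * N)) \<le> (card (Lw N) * (C * card (Lw N))) * card E ^ (m div n)" for m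
  proof -
    have "card (Lw (m + 2 * N)) \<le>
        card (Lw N) * card ((\<lambda>(u, v). u @ v) ` (D m \<times> Lw N))"
    proof (rule card_le_card_mult[OF finL], goal_cases)
      case 1
      then show ?case using finD finL by simp
    next
      case 2
      show ?case
      proof
        fix w assume "w \<in> Lw (m + 2 * N)"
        then have w: "length w = m + 2 * N" "w \<in> L" by (auto simp: Lw_def)
        let ?p = "take N w" and ?u = "take m (drop N w)" and ?q = "drop m (drop N w)"
        have *: "?p @ ?u @ ?q = w" by (metis append_take_drop_id)
        have L3: "[] @ ?p @ (?u @ ?q) \<in> L" "(?p @ ?u) @ ?q @ [] \<in> L" "?p @ ?u @ ?q \<in> L"
          using * w by (simp_all del: drop_drop)
        have mem: "?p \<in> Lw N" "?q \<in> Lw N" "?u \<in> D m"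
          using w(1) factorial_languageD[OF L L3(1)] factorial_languageD[OF L L3(2)]
            extendable_factor[OF L L3(3), of N]
          by (simp_all add: Lw_def D_def)
        have "?u @ ?q \<in> (\<lambda>(u, v). u @ v) ` (D m \<times> Lw N)"
          by (rule image_eqI[of _ _ "(?u, ?q)"]) (use mem in auto)
        then show "w \<in> (\<lambda>(u, v). u @ v) ` (Lw N \<times> (\<lambda>(u, v). u @ v) ` (D m \<times> Lw N))"
          using mem(1) by (intro image_eqI[of _ _ "(?p, ?u @ ?q)"]) (simp_all del: drop_drop)
      qed
    qed
    also have "card ((\<lambda>(u, v). u @ v) ` (D m \<times> Lw N)) \<le> card (D m) * card (Lw N)"
      by (rule card_le_card_mult[OF finD finL subset_refl])
    also have "card (D m) * card (Lw N) \<le> C * card E ^ (m div n) * card (Lw N)"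
      using D_le by (rule mult_le_mono1)
    finally show ?thesis by (simp add: ac_simps)
  qed
  then show "\<exists>C N. \<forall>m. card {w. length w = m + N \<and> w \<in> L} \<le> C * card E ^ (m div n)"
    unfolding Lw_def by blast
qed

text \<open>The common limit is the infimum \<open>c\<close> of \<open>e\<close> over positive
  indices, as in Fekete's lemma: for \<open>b > c\<close> some \<open>e n\<close> is below
  \<open>b\<close>, and \<open>upper\<close> then pushes \<open>l\<close>, hence also
  \<open>e\<close>, eventually below \<open>b\<close>.\<close>

lemma squeezed_limits:
  fixes e l :: "nat \<Rightarrow> real"
  assumes nonneg: "\<And>n. 0 \<le> e n" and le: "\<And>n. e n \<le> l n"
    and upper: "\<And>n. n > 0 \<Longrightarrow> \<exists>K. \<forall>\<^sub>F m in sequentially. l m \<le> K / real m + e n"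
  shows "\<exists>c. e \<longlonglongrightarrow> c \<and> l \<longlonglongrightarrow> c"
proof -
  \<comment> \<open>Index 0 is left out: in the application \<open>e 0\<close> is a division by zero
    with value 0, which would drag the infimum down.\<close>
  define c where "c = Inf (e ` {0<..})"
  have bdd: "bdd_below (e ` {0<..})" using nonneg by (auto simp: bdd_below_def)
  have ce: "c \<le> e n" if "n > 0" for n
    unfolding c_def using bdd that by (intro cInf_lower) auto
  have l_less: "\<forall>\<^sub>F m in sequentially. l m < b" if cb: "c < b" for b
  proof -
    obtain n where n: "n > 0" "e n < b"
      using cInf_lessD[of "e ` {0<..}" b] cb by (auto simp: c_def)
    obtain K where K: "\<forall>\<^sub>F m in sequentially. l m \<le> K / real m + e n" using upper n(1) by blast
    have "(\<lambda>m. K / real m + e n) \<longlonglongrightarrow> 0 + e n"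
      by (intro tendsto_add tendsto_const lim_const_over_n)
    then have "\<forall>\<^sub>F m in sequentially. K / real m + e n < b"
      using n(2) by (intro order_tendstoD) auto
    with K show ?thesis by eventually_elim simp
  qed
  have ev: "\<forall>\<^sub>F m in sequentially. c \<le> e m"
    using eventually_gt_at_top[of 0] by eventually_elim (rule ce)
  have "e \<longlonglongrightarrow> c"
  proof (rule order_tendstoI)
    show "\<forall>\<^sub>F m in sequentially. a < e m" if "a < c" for a
      using ev by eventually_elim (use that in simp)
    show "\<forall>\<^sub>F m in sequentially. e m < b" if "c < b" for b
      using l_less[OF that] by eventually_elim (use le in \<open>auto intro: le_less_trans\<close>)
  qed
  moreover have "l \<longlonglongrightarrow> c"
  proof (rule order_tendstoI)
    show "\<forall>\<^sub>F m in sequentially. a < l m" if "a < c" for a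
      using ev by eventually_elim (use that le in \<open>meson less_le_trans\<close>)
  qed (rule l_less)
  ultimately show ?thesis by blast
qed

lemma entropy_avoiding_complement:
  fixes L :: "'a list set"
  assumes L: "factorial_language L" and fin: "finite (UNIV :: 'a set)"
    and ne: "\<And>m. \<exists>w\<in>L. length w = m"
  shows "entropy (avoiding (- L) :: (int \<Rightarrow> 'a) set) =
    lim (\<lambda>n. log 2 (real (card {w. length w = n \<and> w \<in> L})) / real n)"
proof -
  define E where "E n = card (blocks n (avoiding (- L) :: (int \<Rightarrow> 'a) set))" for n
  define M where "M n = card {w. length w = n \<and> w \<in> L}" for n
  define e where "e n = log 2 (real (E n)) / real n" for n
  define l where "l n = log 2 (real (M n)) / real n" for n
  have E_pos: "E n > 0" if "n > 0" for n
    using card_factorial_language_le(1)[OF L fin that ne] by (simp add: E_def)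
  have EM: "E n \<le> M n" for n
    unfolding E_def M_def by (intro card_mono finite_words_length[OF fin] blocks_avoiding_subset)
  have nonneg: "0 \<le> e n" for n
    using E_pos[of n] by (cases "n = 0") (auto simp: e_def)
  have le: "e n \<le> l n" for n
  proof (cases "n = 0")
    case False
    then show ?thesis using E_pos[of n] EM[of n]
      by (auto simp: e_def l_def intro!: divide_right_mono)
  qed (simp add: e_def l_def)
  have "\<exists>K. \<forall>\<^sub>F m in sequentially. l m \<le> K / real m + e n" if n: "n > 0" for n
  proof -
    obtain C N where CN: "\<And>m. M (m + N) \<le> C * E n ^ (m div n)"
      using card_factorial_language_le(2)[OF L fin n ne] by (auto simp: E_def M_def)
    \<comment> \<open>Taking logarithms of the counting bound, the factor \<open>C\<close>
      contributes a term vanishing as \<open>m\<close> grows, and \<open>(m - N) div n\<close> is at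
      most \<open>m / n\<close>.\<close>
    have "l m \<le> log 2 (real C) / real m + e n" if m: "m > N" for m
    proof -
      have Mm: "M m > 0" using E_pos[of m] EM[of m] m by simp
      have le: "M m \<le> C * E n ^ ((m - N) div n)" using CN[of "m - N"] m by simp
      with Mm have C: "C > 0" by (metis bot_nat_0.not_eq_extremum le_zero_eq mult_0)
      have logE: "0 \<le> log 2 (real (E n))" using E_pos[OF n] by simp
      have "real ((m - N) div n) \<le> real m / real n"
        using of_nat_div_le_of_nat[where ?'a = real, of "m - N" n] by (rule order_trans) (simp add: divide_right_mono)
      then have d: "real ((m - N) div n) * log 2 (real (E n)) \<le> real m / real n * log 2 (real (E n))"
        using logE by (rule mult_right_mono)
      have "log 2 (real (M m)) \<le> log 2 (real (C * E n ^ ((m - N) div n)))"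
        using Mm le by (intro log_mono) (auto simp del: of_nat_mult of_nat_power)
      also have "\<dots> = log 2 (real C) + real ((m - N) div n) * log 2 (real (E n))"
        using C E_pos[OF n] by (simp add: log_mult log_nat_power)
      also have "\<dots> \<le> log 2 (real C) + real m * e n"
        using d by (simp add: e_def)
      finally show ?thesis using m by (simp add: l_def field_simps)
    qed
    then show ?thesis using eventually_gt_at_top[of N] by (metis (mono_tags, lifting) eventually_mono)
  qed
  from squeezed_limits[OF nonneg le this]
  obtain c where "e \<longlonglongrightarrow> c" "l \<longlonglongrightarrow> c" by blast
  then have "lim e = lim l" by (simp add: limI)
  then show ?thesis unfolding entropy_def e_def[abs_def] l_def[abs_def] E_def M_def .
qed

text \<open>The winning language is factorial and has as many words of each length as
  \<open>language X\<close>, so its growth rate is the entropy of \<open>X\<close>.\<close>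

lemma entropy_winning_shift_int:
  fixes X :: "(int \<Rightarrow> 's) set"
  assumes "CARD('s) = 2" "X \<noteq> {}"
  shows "entropy (winning_shift_int X) = entropy X"
proof -
  let ?L = "{a. wins a (language X)}"
  \<comment> \<open>Winning turn orders of every length exist because their number equals that of
    the blocks of \<open>X\<close>.\<close>
  have "\<exists>a\<in>?L. length a = m" for m
  proof -
    have "{w. length w = m \<and> w \<in> language X} \<noteq> {}"
      using language_nonempty[OF assms(2)] by blast
    moreover have "finite (UNIV :: 's set)" using assms(1) by (simp add: card_ge_0_finite)
    ultimately have "card {w. length w = m \<and> w \<in> language X} \<noteq> 0"
      by (simp add: finite_words_length del: Collect_empty_eq)
    then have "card {a. length a = m \<and> wins a (language X)} \<noteq> 0"
      by (simp add: card_wins[OF assms(1)])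
    then show ?thesis by (metis (mono_tags, lifting) card.empty empty_Collect_eq mem_Collect_eq)
  qed
  from entropy_avoiding_complement[OF factorial_language_wins[OF factorial_language_language]
      finite_UNIV_player this]
  show ?thesis
    by (simp add: winning_shift_int_def winning_language_eq)
      (simp add: entropy_def card_blocks_eq_card_wins[OF assms(1)])
qed

theorem corollary5p5:
  assumes binary: "CARD('s) = 2"
  shows "(\<forall>X :: (nat \<Rightarrow> 's) set. subshift X \<and> X \<noteq> {} \<longrightarrow> entropy X = entropy (winning_shift_nat X))
       \<and> (\<forall>X :: (int \<Rightarrow> 's) set. subshift X \<and> X \<noteq> {} \<longrightarrow> entropy X = entropy (winning_shift_int X))"
  using entropy_winning_shift_int[OF binary]
  \<comment> \<open>In the one-sided case the block counts already agree for every length, so no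
    limit argument is required.\<close>
  by (auto simp: entropy_def blocks_winning_shift_nat card_blocks_eq_card_wins[OF binary])

end
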